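(* Let $\mathbf V$ be a variety of loops, $\mathcal W$ a set of words generating inner mapping groups in $\mathbf V$, and $Q\in\mathbf V$. Then $$Q'=\langle W_{\bar x}(z)/z : W\in\mathcal W,\ \bar x\text{ a tuple over }Q,\ z\in Q\rangle,$$ where the right-hand side is the subloop generated by the indicated elements.
   Context: A loop is an algebra $(Q,1,\cdot,\backslash,/)$ satisfying $x\cdot 1=x=1\cdot x$, $x\backslash(x\cdot y)=y$, $x\cdot(x\backslash y)=y$, $(y\cdot x)/x=y$, $(y/x)\cdot x=y$. A subloop $N$ of $Q$ is normal if $xN=Nx$, $x(yN)=(xy)N$, $N(xy)=(Nx)y$ for all $x,y\in Q$. The derived subloop $Q'$ is the smallest normal subloop of $Q$ such that $Q/Q'$ is an abelian group. For $x\in Q$ define bijections of $Q$ by $L_x(y)=xy$, $R_x(y)=yx$, $M_x(y)=y\backslash x$. Put $\mathrm{Mlt}(Q)=\langle L_x,R_x : x\in Q\rangle$, $\mathrm{TMlt}(Q)=\langle L_x,R_x,M_x : x\in Q\rangle$; $\mathrm{Inn}(Q)$ and $\mathrm{TInn}(Q)$ are the stabilizers of $1$ in $\mathrm{Mlt}(Q)$ and $\mathrm{TMlt}(Q)$, respectively. A word $W=W_{\bar x}$ in a finite tuple of variables $\bar x=x_1,\dots,x_n$ is an element of the free group on the letters $K_t$, where $K\in\{L,R,M\}$ and $t$ is a loop term over $\bar x$. For a loop $Q$ and a tuple $\bar a$ over $Q$, $W_{\bar a}\in\mathrm{TMlt}(Q)$ is the mapping obtained by replacing each letter $K_{t(\bar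 x)}^{\pm1}$ by the actual mapping $K_{t(\bar a)}^{\pm1}$ of $Q$. The word $W$ is inner for a variety $\mathbf V$ of loops if $W_{\bar a}\in\mathrm{TInn}(Q)$ for every $Q\in\mathbf V$ and every tuple $\bar a$ over $Q$. A set $\mathcal W$ of inner words for $\mathbf V$ generates inner mapping groups in $\mathbf V$ if $\mathrm{Inn}(Q)=\langle W_{\bar a} : W\in\mathcal W,\ \bar a\text{ a tuple over }Q\rangle$ for every $Q\in\mathbf V$. *)

theory Defs
  imports "HOL-Algebra.Algebra"
begin

section \<open>Loops\<close>

text \<open>
  Loops extend the record \<open>monoid\<close> of carrier, product and unit, so that cosets, \<open>Mod\<close> and
  \<open>comm_group\<close> from HOL-Algebra apply to them.
\<close>

record 'a loop = "'a monoid" +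
  ldiv :: "['a, 'a] \<Rightarrow> 'a" (infixl "\<setminus>\<index>" 70)
  rdiv :: "['a, 'a] \<Rightarrow> 'a" (infixl "\<oslash>\<index>" 70)

locale loop =
  fixes Q (structure)
  assumes one_closed: "\<one> \<in> carrier Q"
    and mult_closed: "\<lbrakk>x \<in> carrier Q; y \<in> carrier Q\<rbrakk> \<Longrightarrow> x \<otimes> y \<in> carrier Q"
    and ldiv_closed: "\<lbrakk>x \<in> carrier Q; y \<in> carrier Q\<rbrakk> \<Longrightarrow> x \<setminus> y \<in> carrier Q"
    and rdiv_closed: "\<lbrakk>x \<in> carrier Q; y \<in> carrier Q\<rbrakk> \<Longrightarrow> x \<oslash> y \<in> carrier Q"
    and mult_one: "x \<in> carrier Q \<Longrightarrow> x \<otimes> \<one> = x"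
    and one_mult: "x \<in> carrier Q \<Longrightarrow> \<one> \<otimes> x = x"
    and ldiv_mult: "\<lbrakk>x \<in> carrier Q; y \<in> carrier Q\<rbrakk> \<Longrightarrow> x \<setminus> (x \<otimes> y) = y"
    and mult_ldiv: "\<lbrakk>x \<in> carrier Q; y \<in> carrier Q\<rbrakk> \<Longrightarrow> x \<otimes> (x \<setminus> y) = y"
    and mult_rdiv: "\<lbrakk>x \<in> carrier Q; y \<in> carrier Q\<rbrakk> \<Longrightarrow> (y \<otimes> x) \<oslash> x = y"
    and rdiv_mult: "\<lbrakk>x \<in> carrier Q; y \<in> carrier Q\<rbrakk> \<Longrightarrow> (y \<oslash> x) \<otimes> x = y"

definition subloop :: "'a set \<Rightarrow> ('a, 'b) loop_scheme \<Rightarrow> bool" where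
  "subloop N Q \<longleftrightarrow> N \<subseteq> carrier Q \<and> \<one>\<^bsub>Q\<^esub> \<in> N \<and>
     (\<forall>x\<in>N. \<forall>y\<in>N. x \<otimes>\<^bsub>Q\<^esub> y \<in> N \<and> x \<setminus>\<^bsub>Q\<^esub> y \<in> N \<and> x \<oslash>\<^bsub>Q\<^esub> y \<in> N)"

definition subloop_generated :: "('a, 'b) loop_scheme \<Rightarrow> 'a set \<Rightarrow> 'a set" where
  "subloop_generated Q S = (\<lambda>N. subloop N Q) hull S"

definition normal_subloop :: "'a set \<Rightarrow> ('a, 'b) loop_scheme \<Rightarrow> bool" where
  "normal_subloop N Q \<longleftrightarrow> subloop N Q \<and>
     (\<forall>x\<in>carrier Q. \<forall>y\<in>carrier Q.
        x <#\<^bsub>Q\<^esub> N = N #>\<^bsub>Q\<^esub> x \<and>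
        x <#\<^bsub>Q\<^esub> (y <#\<^bsub>Q\<^esub> N) = (x \<otimes>\<^bsub>Q\<^esub> y) <#\<^bsub>Q\<^esub> N \<and>
        N #>\<^bsub>Q\<^esub> (x \<otimes>\<^bsub>Q\<^esub> y) = (N #>\<^bsub>Q\<^esub> x) #>\<^bsub>Q\<^esub> y)"

text \<open>
  \<open>Q Mod N\<close> is the set of cosets of \<open>N\<close> under elementwise multiplication of sets. For normal \<open>N\<close>
  this is the product \<open>(Nx)(Ny) = N(xy)\<close> of the factor loop. The divisions of the factor loop
  are determined by its product and play no role in its being an abelian group.
\<close>

definition derived_subloop :: "('a, 'b) loop_scheme \<Rightarrow> 'a set" where
  "derived_subloop Q = (LEAST N. normal_subloop N Q \<and> comm_group (Q Mod N))"


section \<open>Multiplication groups\<close>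

datatype translation = Left_Mult | Right_Mult | Middle_Div

text \<open>The maps \<open>L\<^sub>x\<close>, \<open>R\<^sub>x\<close>, \<open>M\<^sub>x\<close>, as elements of \<open>BijGroup (carrier Q)\<close>.\<close>

fun translation_map :: "('a, 'b) loop_scheme \<Rightarrow> translation \<Rightarrow> 'a \<Rightarrow> ('a \<Rightarrow> 'a)" where
  "translation_map Q Left_Mult x = (\<lambda>y\<in>carrier Q. x \<otimes>\<^bsub>Q\<^esub> y)"
| "translation_map Q Right_Mult x = (\<lambda>y\<in>carrier Q. y \<otimes>\<^bsub>Q\<^esub> x)"
| "translation_map Q Middle_Div x = (\<lambda>y\<in>carrier Q. y \<setminus>\<^bsub>Q\<^esub> x)"

definition Mlt :: "('a, 'b) loop_scheme \<Rightarrow> ('a \<Rightarrow> 'a) set" where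
  "Mlt Q = generate (BijGroup (carrier Q))
     {translation_map Q K x | K x. K \<in> {Left_Mult, Right_Mult} \<and> x \<in> carrier Q}"

definition TMlt :: "('a, 'b) loop_scheme \<Rightarrow> ('a \<Rightarrow> 'a) set" where
  "TMlt Q = generate (BijGroup (carrier Q))
     {translation_map Q K x | K x. K \<in> {Left_Mult, Right_Mult, Middle_Div} \<and> x \<in> carrier Q}"

definition Inn :: "('a, 'b) loop_scheme \<Rightarrow> ('a \<Rightarrow> 'a) set" where
  "Inn Q = {f \<in> Mlt Q. f \<one>\<^bsub>Q\<^esub> = \<one>\<^bsub>Q\<^esub>}"

definition TInn :: "('a, 'b) loop_scheme \<Rightarrow> ('a \<Rightarrow> 'a) set" where
  "TInn Q = {f \<in> TMlt Q. f \<one>\<^bsub>Q\<^esub> = \<one>\<^bsub>Q\<^esub>}"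


section \<open>Loop terms and varieties of loops\<close>

datatype loop_term =
    Var nat
  | One
  | Mult loop_term loop_term
  | LDiv loop_term loop_term
  | RDiv loop_term loop_term

fun vars :: "loop_term \<Rightarrow> nat set" where
  "vars (Var i) = {i}"
| "vars One = {}"
| "vars (Mult s t) = vars s \<union> vars t"
| "vars (LDiv s t) = vars s \<union> vars t"
| "vars (RDiv s t) = vars s \<union> vars t"

fun term_value :: "('a, 'b) loop_scheme \<Rightarrow> (nat \<Rightarrow> 'a) \<Rightarrow> loop_term \<Rightarrow> 'a" where
  "term_value Q \<rho> (Var i) = \<rho> i"
| "term_value Q \<rho> One = \<one>\<^bsub>Q\<^esub>"
| "term_value Q \<rho> (Mult s t) = term_value Q \<rho> s \<otimes>\<^bsub>Q\<^esub> term_value Q \<rho> t"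
| "term_value Q \<rho> (LDiv s t) = term_value Q \<rho> s \<setminus>\<^bsub>Q\<^esub> term_value Q \<rho> t"
| "term_value Q \<rho> (RDiv s t) = term_value Q \<rho> s \<oslash>\<^bsub>Q\<^esub> term_value Q \<rho> t"

definition satisfies :: "('a, 'b) loop_scheme \<Rightarrow> loop_term \<times> loop_term \<Rightarrow> bool" where
  "satisfies Q e \<longleftrightarrow>
     (\<forall>\<rho>. range \<rho> \<subseteq> carrier Q \<longrightarrow> term_value Q \<rho> (fst e) = term_value Q \<rho> (snd e))"

text \<open>
  A variety of loops is the class of all loops satisfying some set of identities. As HOL cannot
  quantify over types, only the members with carrier contained in the type \<open>'a\<close> are collected; \<open>'a\<close>
  is arbitrary.
\<close>

definition loop_variety :: "'a loop set \<Rightarrow> bool" where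
  "loop_variety V \<longleftrightarrow> (\<exists>E. V = {Q. loop Q \<and> (\<forall>e\<in>E. satisfies Q e)})"


section \<open>Words and inner words\<close>

text \<open>
  The letter \<open>((K, t), True)\<close> stands for \<open>K\<^sub>t\<close>, and \<open>((K, t), False)\<close> for its formal inverse. An element
  of the free group on the \<open>K\<^sub>t\<close> is represented by its unique freely reduced word. The variables of
  a word of arity \<open>n\<close> are \<open>Var 0, \<dots>, Var (n - 1)\<close>.
\<close>

type_synonym letter = "(translation \<times> loop_term) \<times> bool"

datatype word = Word (arity: nat) (letters: "letter list")

definition words :: "word set" where
  "words = {W. (\<forall>((K, t), b) \<in> set (letters W). vars t \<subseteq> {..<arity W}) \<and>
     successively (\<lambda>(g, b) (h, c). \<not> (g = h \<and> b \<noteq> c)) (letters W)}"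

definition tuples :: "('a, 'b) loop_scheme \<Rightarrow> nat \<Rightarrow> 'a list set" where
  "tuples Q n = {a. length a = n \<and> set a \<subseteq> carrier Q}"

fun letter_map :: "('a, 'b) loop_scheme \<Rightarrow> 'a list \<Rightarrow> letter \<Rightarrow> ('a \<Rightarrow> 'a)" where
  "letter_map Q a ((K, t), True) = translation_map Q K (term_value Q ((!) a) t)"
| "letter_map Q a ((K, t), False) =
     inv\<^bsub>BijGroup (carrier Q)\<^esub> (translation_map Q K (term_value Q ((!) a) t))"

definition word_map :: "('a, 'b) loop_scheme \<Rightarrow> word \<Rightarrow> 'a list \<Rightarrow> ('a \<Rightarrow> 'a)" where
  "word_map Q W a =
     foldr (\<lambda>l f. letter_map Q a l \<otimes>\<^bsub>BijGroup (carrier Q)\<^esub> f) (letters W) \<one>\<^bsub>BijGroup (carrier Q)\<^esub>"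

definition inner_word :: "'a loop set \<Rightarrow> word \<Rightarrow> bool" where
  "inner_word V W \<longleftrightarrow> W \<in> words \<and> (\<forall>Q\<in>V. \<forall>a\<in>tuples Q (arity W). word_map Q W a \<in> TInn Q)"

definition generates_inner_mapping_groups :: "'a loop set \<Rightarrow> word set \<Rightarrow> bool" where
  "generates_inner_mapping_groups V \<W> \<longleftrightarrow>
     (\<forall>W\<in>\<W>. inner_word V W) \<and>
     (\<forall>Q\<in>V. Inn Q = generate (BijGroup (carrier Q))
        {word_map Q W a | W a. W \<in> \<W> \<and> a \<in> tuples Q (arity W)})"

end

theory Submission
  imports Defs
begin

text \<open>
  Let \<open>D\<close> be the generated subloop. As \<open>f d = (f d \<oslash> d) \<otimes> d\<close> for the generators \<open>f\<close> of \<open>Inn Q\<close>,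
  \<open>D\<close> is invariant under \<open>Inn Q\<close> and hence normal. Moreover, \<open>Inn Q\<close> fixes every coset of \<open>D\<close>.
  Since \<open>x(yz)\<close> and \<open>(xy)z\<close>, and likewise \<open>zx\<close> and \<open>xz\<close>, differ by an inner mapping applied to \<open>z\<close>,
  the factor loop is an abelian group. Conversely, if \<open>Q/N\<close> is an abelian group, then \<open>Mlt Q\<close> acts
  on it by translations, so that inner mappings act trivially and \<open>f z \<oslash> z\<close> lies in \<open>N\<close>.
\<close>

section \<open>Pointwise evaluation of products and inverses in \<open>BijGroup\<close>\<close>

lemma Bij_apply_inv:
  assumes "f \<in> Bij S" "z \<in> S"
  shows "f ((inv\<^bsub>BijGroup S\<^esub> f) z) = z" "(inv\<^bsub>BijGroup S\<^esub> f) z \<in> S"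
  using assms by (auto simp: inv_BijGroup Bij_def bij_betw_def f_inv_into_f inv_into_into)

lemma Bij_inv_apply:
  assumes "f \<in> Bij S" "z \<in> S"
  shows "(inv\<^bsub>BijGroup S\<^esub> f) (f z) = z"
  using assms by (auto simp: inv_BijGroup Bij_def bij_betw_def)

lemma BijGroup_mult_apply:
  assumes "f \<in> Bij S" "g \<in> Bij S" "z \<in> S"
  shows "(f \<otimes>\<^bsub>BijGroup S\<^esub> g) z = f (g z)"
  using assms by (simp add: BijGroup_def compose_def)

lemma Bij_closed: "f \<in> Bij S \<Longrightarrow> z \<in> S \<Longrightarrow> f z \<in> S"
  by (auto simp: Bij_def bij_betw_def)

context loop
begin

section \<open>The multiplication group and inner mappings\<close>

lemma translation_map_Bij:
  assumes "K \<in> {Left_Mult, Right_Mult}" "x \<in> carrier Q"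
  shows "translation_map Q K x \<in> Bij (carrier Q)"
proof -
  have "bij_betw (\<lambda>y\<in>carrier Q. x \<otimes> y) (carrier Q) (carrier Q)"
    by (rule bij_betwI[where g = "\<lambda>y. x \<setminus> y"])
      (use assms(2) in \<open>auto simp: mult_closed ldiv_closed ldiv_mult mult_ldiv\<close>)
  moreover have "bij_betw (\<lambda>y\<in>carrier Q. y \<otimes> x) (carrier Q) (carrier Q)"
    by (rule bij_betwI[where g = "\<lambda>y. y \<oslash> x"])
      (use assms(2) in \<open>auto simp: mult_closed rdiv_closed mult_rdiv rdiv_mult\<close>)
  ultimately show ?thesis
    using assms(1) by (auto simp: Bij_def)
qed

lemma Mlt_subgroup: "subgroup (Mlt Q) (BijGroup (carrier Q))"
  unfolding Mlt_def
  by (intro group.generate_is_subgroup group_BijGroup)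
    (use translation_map_Bij in \<open>auto simp: BijGroup_def\<close>)

lemma Mlt_Bij: "f \<in> Mlt Q \<Longrightarrow> f \<in> Bij (carrier Q)"
  using subgroup.mem_carrier[OF Mlt_subgroup] by (simp add: BijGroup_def)

lemma Inn_Bij: "f \<in> Inn Q \<Longrightarrow> f \<in> Bij (carrier Q)"
  by (simp add: Inn_def Mlt_Bij)

lemma translation_map_Mlt:
  "K \<in> {Left_Mult, Right_Mult} \<Longrightarrow> x \<in> carrier Q \<Longrightarrow> translation_map Q K x \<in> Mlt Q"
  unfolding Mlt_def by (rule generate.incl) blast

text \<open>This lemma and the next three offer translations and their composites as members of
  \<open>Mlt Q\<close> known only through their values on the carrier, so that later arguments need
  not unfold the restricted functions or the product of \<open>BijGroup\<close>.\<close>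

lemma left_left_Mlt:
  assumes "x \<in> carrier Q" "y \<in> carrier Q"
  obtains g where "g \<in> Mlt Q" "\<And>z. z \<in> carrier Q \<Longrightarrow> g z = x \<otimes> (y \<otimes> z)"
proof
  let ?L = "translation_map Q Left_Mult"
  show "?L x \<otimes>\<^bsub>BijGroup (carrier Q)\<^esub> ?L y \<in> Mlt Q"
    by (intro subgroup.m_closed[OF Mlt_subgroup] translation_map_Mlt) (use assms in auto)
  show "(?L x \<otimes>\<^bsub>BijGroup (carrier Q)\<^esub> ?L y) z = x \<otimes> (y \<otimes> z)" if "z \<in> carrier Q" for z
    using that assms translation_map_Bij[of Left_Mult]
    \<comment> \<open>The translations stay folded at first, so that their membership in
      \<open>Bij\<close> can discharge the premises of \<open>BijGroup_mult_apply\<close>; the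
      second \<open>simp\<close> evaluates them.\<close>
    by (simp add: BijGroup_mult_apply mult_closed del: translation_map.simps)
      (simp add: mult_closed)
qed

lemma right_right_Mlt:
  assumes "x \<in> carrier Q" "y \<in> carrier Q"
  obtains g where "g \<in> Mlt Q" "\<And>z. z \<in> carrier Q \<Longrightarrow> g z = (z \<otimes> x) \<otimes> y"
proof
  let ?R = "translation_map Q Right_Mult"
  show "?R y \<otimes>\<^bsub>BijGroup (carrier Q)\<^esub> ?R x \<in> Mlt Q"
    by (intro subgroup.m_closed[OF Mlt_subgroup] translation_map_Mlt) (use assms in auto)
  show "(?R y \<otimes>\<^bsub>BijGroup (carrier Q)\<^esub> ?R x) z = (z \<otimes> x) \<otimes> y" if "z \<in> carrier Q" for z
    using that assms translation_map_Bij[of Right_Mult]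
    by (simp add: BijGroup_mult_apply mult_closed del: translation_map.simps)
      (simp add: mult_closed)
qed

lemma left_Mlt:
  assumes "x \<in> carrier Q"
  obtains g where "g \<in> Mlt Q" "\<And>z. z \<in> carrier Q \<Longrightarrow> g z = x \<otimes> z"
  using translation_map_Mlt[of Left_Mult x] assms by auto

lemma right_Mlt:
  assumes "x \<in> carrier Q"
  obtains g where "g \<in> Mlt Q" "\<And>z. z \<in> carrier Q \<Longrightarrow> g z = z \<otimes> x"
  using translation_map_Mlt[of Right_Mult x] assms by auto

text \<open>The witness is the inverse of \<open>h\<close> composed with \<open>g\<close>, which
  fixes \<open>\<one>\<close> because \<open>g\<close> and \<open>h\<close> agree there. Normality
  of a subloop, and commutativity and associativity modulo it, are all reduced to inner mappings by
  this lemma.\<close>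

lemma Mlt_differ_by_Inn:
  assumes "g \<in> Mlt Q" "h \<in> Mlt Q" "g \<one> = h \<one>"
  obtains f where "f \<in> Inn Q" "\<And>z. z \<in> carrier Q \<Longrightarrow> g z = h (f z)"
proof
  let ?B = "BijGroup (carrier Q)"
  have B: "g \<in> Bij (carrier Q)" "h \<in> Bij (carrier Q)" "inv\<^bsub>?B\<^esub> h \<in> Bij (carrier Q)"
    using assms Mlt_Bij subgroup.m_inv_closed[OF Mlt_subgroup] by auto
  show "inv\<^bsub>?B\<^esub> h \<otimes>\<^bsub>?B\<^esub> g \<in> Inn Q"
    unfolding Inn_def using assms B one_closed
    by (simp add: subgroup.m_closed[OF Mlt_subgroup] subgroup.m_inv_closed[OF Mlt_subgroup]
        BijGroup_mult_apply Bij_inv_apply)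
  show "g z = h ((inv\<^bsub>?B\<^esub> h \<otimes>\<^bsub>?B\<^esub> g) z)" if "z \<in> carrier Q" for z
    using that B by (simp add: BijGroup_mult_apply Bij_apply_inv Bij_closed)
qed

lemma Mlt_image_eq:
  assumes "N \<subseteq> carrier Q" "\<And>f. f \<in> Inn Q \<Longrightarrow> f ` N \<subseteq> N"
    and "g \<in> Mlt Q" "h \<in> Mlt Q" "g \<one> = h \<one>"
  shows "g ` N = h ` N"
proof -
  have "g ` N \<subseteq> h ` N" if gh: "g \<in> Mlt Q" "h \<in> Mlt Q" "g \<one> = h \<one>" for g h
  proof -
    obtain f where "f \<in> Inn Q" "\<And>z. z \<in> carrier Q \<Longrightarrow> g z = h (f z)"
      using Mlt_differ_by_Inn[OF gh] by blast
    then show ?thesis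
      using assms(1,2) by (fastforce simp: image_subset_iff)
  qed
  then show ?thesis
    using assms(3-5) by (metis subset_antisym)
qed

text \<open>Each normality equation compares the images of \<open>N\<close> under two members of
  \<open>Mlt Q\<close> with the same value at \<open>\<one>\<close>: this value is \<open>x\<close>
  for the first equation and \<open>x \<otimes> y\<close> for the other two.\<close>

lemma normal_subloopI:
  assumes "subloop N Q" and inv: "\<And>f. f \<in> Inn Q \<Longrightarrow> f ` N \<subseteq> N"
  shows "normal_subloop N Q"
  unfolding normal_subloop_def
proof (intro conjI ballI assms(1))
  have N: "N \<subseteq> carrier Q"
    using assms(1) by (simp add: subloop_def)
  note eq = Mlt_image_eq[OF N inv]
  fix x y assume xy: "x \<in> carrier Q" "y \<in> carrier Q"
  note simps = one_closed mult_closed mult_one one_mult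
  obtain g where g: "g \<in> Mlt Q" "\<And>z. z \<in> carrier Q \<Longrightarrow> g z = x \<otimes> z"
    using left_Mlt xy(1) by blast
  obtain h where h: "h \<in> Mlt Q" "\<And>z. z \<in> carrier Q \<Longrightarrow> h z = z \<otimes> x"
    using right_Mlt xy(1) by blast
  have "g ` N = h ` N"
    by (rule eq) (use g h xy in \<open>simp_all add: simps\<close>)
  moreover have "g ` N = x <# N" "h ` N = N #> x"
    using g(2) h(2) N
    by (simp_all add: l_coset_def r_coset_def UNION_singleton_eq_range image_image subset_iff
        cong: image_cong_simp)
  ultimately show "x <# N = N #> x"
    by simp
  obtain g where g: "g \<in> Mlt Q" "\<And>z. z \<in> carrier Q \<Longrightarrow> g z = x \<otimes> (y \<otimes> z)"
    using left_left_Mlt xy by blast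
  obtain h where h: "h \<in> Mlt Q" "\<And>z. z \<in> carrier Q \<Longrightarrow> h z = (x \<otimes> y) \<otimes> z"
    using left_Mlt[OF mult_closed[OF xy]] by blast
  have "g ` N = h ` N"
    by (rule eq) (use g h xy in \<open>simp_all add: simps\<close>)
  moreover have "g ` N = x <# (y <# N)" "h ` N = (x \<otimes> y) <# N"
    using g(2) h(2) N
    by (simp_all add: l_coset_def r_coset_def UNION_singleton_eq_range image_image subset_iff
        cong: image_cong_simp)
  ultimately show "x <# (y <# N) = (x \<otimes> y) <# N"
    by simp
  obtain g where g: "g \<in> Mlt Q" "\<And>z. z \<in> carrier Q \<Longrightarrow> g z = z \<otimes> (x \<otimes> y)"
    using right_Mlt[OF mult_closed[OF xy]] by blast
  obtain h where h: "h \<in> Mlt Q" "\<And>z. z \<in> carrier Q \<Longrightarrow> h z = (z \<otimes> x) \<otimes> y"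
    using right_right_Mlt xy by blast
  have "g ` N = h ` N"
    by (rule eq) (use g h xy in \<open>simp_all add: simps\<close>)
  moreover have "g ` N = N #> (x \<otimes> y)" "h ` N = (N #> x) #> y"
    using g(2) h(2) N
    by (simp_all add: l_coset_def r_coset_def UNION_singleton_eq_range image_image subset_iff
        cong: image_cong_simp)
  ultimately show "N #> (x \<otimes> y) = (N #> x) #> y"
    by simp
qed

section \<open>Cosets of a normal subloop and their products\<close>

lemma normal_subloop_sub: "normal_subloop N Q \<Longrightarrow> N \<subseteq> carrier Q"
  by (simp add: normal_subloop_def subloop_def)

lemma r_coset_self:
  assumes "normal_subloop N Q" "x \<in> carrier Q"
  shows "x \<in> N #> x"
proof -
  have "\<one> \<in> N"
    using assms(1) by (simp add: normal_subloop_def subloop_def)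
  then show ?thesis
    using one_mult[OF assms(2)] unfolding r_coset_def by force
qed

lemma r_coset_mem:
  assumes "normal_subloop N Q" "d \<in> N"
  shows "N #> d = N"
proof -
  have sub: "subloop N Q"
    using assms(1) by (simp add: normal_subloop_def)
  show ?thesis
  proof
    show "N #> d \<subseteq> N"
      using sub assms(2) by (auto simp: subloop_def r_coset_def)
    show "N \<subseteq> N #> d"
    proof
      fix e assume "e \<in> N"
      then have "e \<oslash> d \<in> N" "(e \<oslash> d) \<otimes> d = e"
        using sub assms(2) rdiv_mult[of d e] by (auto simp: subloop_def)
      then show "e \<in> N #> d"
        unfolding r_coset_def by blast
    qed
  qed
qed

text \<open>With \<open>y = d \<otimes> x\<close> and \<open>d\<close> in \<open>N\<close>,
  normality replaces associativity: the coset of \<open>d \<otimes> x\<close> is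
  \<open>(N #> d) #> x\<close>, and \<open>d\<close> is absorbed by \<open>N\<close>.\<close>

lemma r_coset_eq:
  assumes N: "normal_subloop N Q" and "x \<in> carrier Q" "y \<in> N #> x"
  shows "N #> y = N #> x"
proof -
  obtain d where d: "d \<in> N" "y = d \<otimes> x"
    using assms(3) by (auto simp: r_coset_def)
  then have "N #> y = (N #> d) #> x"
    using N assms(2) normal_subloop_sub[OF N] unfolding normal_subloop_def by auto
  then show ?thesis
    using r_coset_mem[OF N d(1)] by simp
qed

text \<open>For a product \<open>p \<otimes> q\<close> the factors are treated one at a time: it
  lies in \<open>(N #> x) #> q\<close>, which is the coset of \<open>x \<otimes> q\<close>; then
  \<open>x \<otimes> q\<close> lies in \<open>x <# (y <# N)\<close>, which is the coset of
  \<open>x \<otimes> y\<close>.\<close>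

lemma coset_mult:
  assumes N: "normal_subloop N Q" and xy: "x \<in> carrier Q" "y \<in> carrier Q"
  shows "(N #> x) <#> (N #> y) = N #> (x \<otimes> y)"
proof
  have sub: "N \<subseteq> carrier Q"
    using N by (rule normal_subloop_sub)
  have comm: "a <# N = N #> a" and l: "a <# (b <# N) = (a \<otimes> b) <# N"
    and r: "N #> (a \<otimes> b) = (N #> a) #> b"
    if "a \<in> carrier Q" "b \<in> carrier Q" for a b
    using N that unfolding normal_subloop_def by blast+
  show "(N #> x) <#> (N #> y) \<subseteq> N #> (x \<otimes> y)"
  proof
    fix u assume "u \<in> (N #> x) <#> (N #> y)"
    then obtain p q where pq: "p \<in> N #> x" "q \<in> N #> y" "u = p \<otimes> q"
      by (auto simp: set_mult_def)
    have q: "q \<in> carrier Q"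
      using pq(2) sub xy(2) by (auto simp: r_coset_def mult_closed)
    have "u \<in> (N #> x) #> q"
      using pq by (auto simp: r_coset_def)
    then have "u \<in> N #> (x \<otimes> q)"
      using r[OF xy(1) q] by simp
    moreover have "x \<otimes> q \<in> N #> (x \<otimes> y)"
    proof -
      have "q \<in> y <# N"
        using pq(2) comm xy(2) by blast
      then have "x \<otimes> q \<in> x <# (y <# N)"
        by (auto simp: l_coset_def)
      then show ?thesis
        using l[OF xy] comm[of "x \<otimes> y" \<one>] mult_closed[OF xy] one_closed by simp
    qed
    ultimately show "u \<in> N #> (x \<otimes> y)"
      using r_coset_eq[OF N mult_closed[OF xy]] by blast
  qed
  \<comment> \<open>The left side is \<open>(N #> x) #> y\<close>, and \<open>y\<close> is itself a
    member of \<open>N #> y\<close>.\<close>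
  show "N #> (x \<otimes> y) \<subseteq> (N #> x) <#> (N #> y)"
    unfolding r[OF xy] r_coset_def[of _ "N #> x"] set_mult_def
    using r_coset_self[OF N xy(2)] by blast
qed

section \<open>Abelian factors and the action of inner mappings on cosets\<close>

lemma factor_comm_group:
  assumes N: "normal_subloop N Q"
    and fixed: "\<And>f z. f \<in> Inn Q \<Longrightarrow> z \<in> carrier Q \<Longrightarrow> f z \<in> N #> z"
  shows "comm_group (Q Mod N)"
proof -
  have N1: "N #> \<one> = N"
    by (rule r_coset_mem[OF N]) (use N in \<open>simp add: normal_subloop_def subloop_def\<close>)
  note mult = coset_mult[OF N]
  have car: "C \<in> carrier (Q Mod N) \<longleftrightarrow> (\<exists>x\<in>carrier Q. C = N #> x)" for C
    by (auto simp: FactGroup_def RCOSETS_def)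
  have fix_eq: "N #> f z = N #> z" "f z \<in> carrier Q" if "f \<in> Inn Q" "z \<in> carrier Q" for f z
    by (rule r_coset_eq[OF N that(2) fixed[OF that]]) (rule Bij_closed[OF Inn_Bij[OF that(1)] that(2)])
  \<comment> \<open>Right and left multiplication by \<open>y\<close> agree at
    \<open>\<one>\<close>, so \<open>x \<otimes> y = y \<otimes> f x\<close> with \<open>f\<close>
    inner, and \<open>f x\<close> has the same coset as \<open>x\<close>.\<close>
  have comm: "N #> (x \<otimes> y) = N #> (y \<otimes> x)" if xy: "x \<in> carrier Q" "y \<in> carrier Q" for x y
  proof -
    obtain g where g: "g \<in> Mlt Q" "\<And>z. z \<in> carrier Q \<Longrightarrow> g z = z \<otimes> y"
      using right_Mlt xy(2) by blast
    obtain h where h: "h \<in> Mlt Q" "\<And>z. z \<in> carrier Q \<Longrightarrow> h z = y \<otimes> z"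
      using left_Mlt xy(2) by blast
    have eq: "g \<one> = h \<one>"
      using g(2) h(2) xy by (simp add: one_closed one_mult mult_one)
    obtain f where f: "f \<in> Inn Q" "\<And>z. z \<in> carrier Q \<Longrightarrow> g z = h (f z)"
      using Mlt_differ_by_Inn[OF g(1) h(1) eq] by blast
    have "N #> (x \<otimes> y) = N #> (y \<otimes> f x)"
      using f(2)[OF xy(1)] g(2)[OF xy(1)] h(2)[OF fix_eq(2)[OF f(1) xy(1)]] by simp
    also have "\<dots> = N #> (y \<otimes> x)"
      using mult[OF xy(2) fix_eq(2)[OF f(1) xy(1)]] mult[OF xy(2,1)] fix_eq(1)[OF f(1) xy(1)]
      by simp
    finally show ?thesis .
  qed
  have assoc: "N #> (x \<otimes> (y \<otimes> z)) = N #> ((x \<otimes> y) \<otimes> z)"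
    if xyz: "x \<in> carrier Q" "y \<in> carrier Q" "z \<in> carrier Q" for x y z
  proof -
    obtain g where g: "g \<in> Mlt Q" "\<And>z. z \<in> carrier Q \<Longrightarrow> g z = x \<otimes> (y \<otimes> z)"
      using left_left_Mlt xyz(1,2) by blast
    have xy: "x \<otimes> y \<in> carrier Q"
      using xyz by (simp add: mult_closed)
    then obtain h where h: "h \<in> Mlt Q" "\<And>z. z \<in> carrier Q \<Longrightarrow> h z = (x \<otimes> y) \<otimes> z"
      using left_Mlt by blast
    have eq: "g \<one> = h \<one>"
      using g(2) h(2) xyz xy by (simp add: one_closed mult_one)
    obtain f where f: "f \<in> Inn Q" "\<And>z. z \<in> carrier Q \<Longrightarrow> g z = h (f z)"
      using Mlt_differ_by_Inn[OF g(1) h(1) eq] by blast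
    have "N #> (x \<otimes> (y \<otimes> z)) = N #> ((x \<otimes> y) \<otimes> f z)"
      using f(2)[OF xyz(3)] g(2)[OF xyz(3)] h(2)[OF fix_eq(2)[OF f(1) xyz(3)]] by simp
    also have "\<dots> = N #> ((x \<otimes> y) \<otimes> z)"
      using mult[OF xy fix_eq(2)[OF f(1) xyz(3)]] mult[OF xy xyz(3)] fix_eq(1)[OF f(1) xyz(3)]
      by simp
    finally show ?thesis .
  qed
  have op: "C \<otimes>\<^bsub>Q Mod N\<^esub> C' = C <#> C'" and one: "\<one>\<^bsub>Q Mod N\<^esub> = N" for C C'
    by (simp_all add: FactGroup_def)
  show ?thesis
  proof (rule comm_groupI)
    fix C C' assume "C \<in> carrier (Q Mod N)" "C' \<in> carrier (Q Mod N)"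
    then obtain x y where xy: "x \<in> carrier Q" "y \<in> carrier Q" "C = N #> x" "C' = N #> y"
      unfolding car by blast
    show "C \<otimes>\<^bsub>Q Mod N\<^esub> C' \<in> carrier (Q Mod N)" "C \<otimes>\<^bsub>Q Mod N\<^esub> C' = C' \<otimes>\<^bsub>Q Mod N\<^esub> C"
      unfolding car op using mult[OF xy(1,2)] mult[OF xy(2,1)] mult_closed[OF xy(1,2)] comm[OF xy(1,2)]
      by (auto simp: xy(3,4))
  next
    show "\<one>\<^bsub>Q Mod N\<^esub> \<in> carrier (Q Mod N)"
      unfolding car one by (rule bexI[of _ \<one>]) (simp_all only: N1 one_closed)
  next
    fix C C' C'' assume "C \<in> carrier (Q Mod N)" "C' \<in> carrier (Q Mod N)" "C'' \<in> carrier (Q Mod N)"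
    then obtain x y z where "x \<in> carrier Q" "y \<in> carrier Q" "z \<in> carrier Q"
      "C = N #> x" "C' = N #> y" "C'' = N #> z"
      unfolding car by blast
    then show "C \<otimes>\<^bsub>Q Mod N\<^esub> C' \<otimes>\<^bsub>Q Mod N\<^esub> C'' = C \<otimes>\<^bsub>Q Mod N\<^esub> (C' \<otimes>\<^bsub>Q Mod N\<^esub> C'')"
      unfolding op by (simp add: mult mult_closed assoc)
  next
    fix C assume "C \<in> carrier (Q Mod N)"
    then obtain x where x: "x \<in> carrier Q" "C = N #> x"
      unfolding car by blast
    then show "\<one>\<^bsub>Q Mod N\<^esub> \<otimes>\<^bsub>Q Mod N\<^esub> C = C"
      unfolding op one using mult[OF one_closed x(1)] N1 one_mult by simp
    \<comment> \<open>Right division solves the equation for a left inverse: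
      \<open>(\<one> \<oslash> x) \<otimes> x = \<one>\<close>.\<close>
    have "(N #> (\<one> \<oslash> x)) <#> C = N"
      using mult[of "\<one> \<oslash> x" x] x N1 rdiv_closed rdiv_mult one_closed by simp
    then show "\<exists>C'\<in>carrier (Q Mod N). C' \<otimes>\<^bsub>Q Mod N\<^esub> C = \<one>\<^bsub>Q Mod N\<^esub>"
      unfolding op one using car rdiv_closed one_closed x(1) by metis
  qed
qed

text \<open>Induction on the generation of \<open>Mlt Q\<close>. Commutativity of the factor lets a
  right multiplication act as a left translation by the same coset; associativity handles
  composites, and inverses in the factor handle inverse mappings.\<close>

lemma Mlt_acts_by_translation:
  assumes N: "normal_subloop N Q" and G: "comm_group (Q Mod N)" and "f \<in> Mlt Q"
  shows "\<exists>C\<in>carrier (Q Mod N). \<forall>z\<in>carrier Q. N #> f z = C <#> (N #> z)"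
proof -
  interpret G: comm_group "Q Mod N" by (rule G)
  let ?B = "BijGroup (carrier Q)"
  let ?T = "\<lambda>f. \<exists>C\<in>carrier (Q Mod N). \<forall>z\<in>carrier Q. N #> f z = C <#> (N #> z)"
  have op: "C \<otimes>\<^bsub>Q Mod N\<^esub> C' = C <#> C'" and one: "\<one>\<^bsub>Q Mod N\<^esub> = N" for C C'
    by (simp_all add: FactGroup_def)
  have car: "N #> x \<in> carrier (Q Mod N)" if "x \<in> carrier Q" for x
    using that by (auto simp: FactGroup_def RCOSETS_def)
  have base: "?T (translation_map Q K x)"
    if "K \<in> {Left_Mult, Right_Mult}" "x \<in> carrier Q" for K x
  proof (intro bexI ballI)
    fix z assume z: "z \<in> carrier Q"
    show "N #> translation_map Q K x z = (N #> x) <#> (N #> z)"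
      using that(1) z coset_mult[OF N that(2) z] coset_mult[OF N z that(2)]
        G.m_comm[OF car[OF z] car[OF that(2)], unfolded op]
      by auto
  qed (rule car[OF that(2)])
  from \<open>f \<in> Mlt Q\<close>[unfolded Mlt_def] show ?thesis
  proof (induction rule: generate.induct)
    case one
    have "\<one>\<^bsub>?B\<^esub> z = z" if "z \<in> carrier Q" for z
      using that by (simp add: BijGroup_def)
    then show ?case
      using G.one_closed G.l_one[OF car, unfolded op one] by (intro bexI[of _ N]) (auto simp: one)
  next
    case (incl h)
    then show ?case
      using base by blast
  next
    case (inv h)
    then have h: "?T h" "h \<in> Bij (carrier Q)"
      using base translation_map_Bij by blast+
    then obtain C where C: "C \<in> carrier (Q Mod N)"
      "\<And>z. z \<in> carrier Q \<Longrightarrow> N #> h z = C <#> (N #> z)"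
      by blast
    have "N #> (inv\<^bsub>?B\<^esub> h) z = inv\<^bsub>Q Mod N\<^esub> C <#> (N #> z)" if z: "z \<in> carrier Q" for z
    proof -
      note w = Bij_apply_inv[OF h(2) z]
      \<comment> \<open>The formula for \<open>h\<close> is used at the preimage of \<open>z\<close>
        and then solved for the coset of that preimage.\<close>
      have "N #> z = C \<otimes>\<^bsub>Q Mod N\<^esub> (N #> (inv\<^bsub>?B\<^esub> h) z)"
        using C(2)[OF w(2)] w(1) by (simp add: op)
      then show ?thesis
        using G.inv_solve_left'[OF car[OF w(2)] C(1) car[OF z]] unfolding op by metis
    qed
    then show ?case
      using G.inv_closed[OF C(1)] by blast
  next
    case (eng f g)
    then have B: "f \<in> Bij (carrier Q)" "g \<in> Bij (carrier Q)"
      using Mlt_Bij unfolding Mlt_def by blast+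
    obtain C C' where C: "C \<in> carrier (Q Mod N)" "C' \<in> carrier (Q Mod N)"
      "\<And>z. z \<in> carrier Q \<Longrightarrow> N #> f z = C <#> (N #> z)"
      "\<And>z. z \<in> carrier Q \<Longrightarrow> N #> g z = C' <#> (N #> z)"
      using eng by blast
    have "N #> (f \<otimes>\<^bsub>?B\<^esub> g) z = (C \<otimes>\<^bsub>Q Mod N\<^esub> C') <#> (N #> z)" if "z \<in> carrier Q" for z
      using that B C G.m_assoc[OF C(1,2) car[OF that], unfolded op]
      by (simp add: BijGroup_mult_apply Bij_closed op)
    then show ?case
      using G.m_closed[OF C(1,2)] by blast
  qed
qed

text \<open>The coset by which \<open>f\<close> translates is found by evaluation at
  \<open>\<one>\<close>: it must be \<open>N\<close>, as \<open>f\<close> fixes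
  \<open>\<one>\<close>. Hence \<open>f z = n \<otimes> z\<close> with \<open>n\<close> in
  \<open>N\<close>, and dividing by \<open>z\<close> on the right returns \<open>n\<close>.\<close>

lemma Inn_rdiv_mem:
  assumes N: "normal_subloop N Q" and G: "comm_group (Q Mod N)"
    and f: "f \<in> Inn Q" and z: "z \<in> carrier Q"
  shows "f z \<oslash> z \<in> N"
proof -
  interpret G: comm_group "Q Mod N" by (rule G)
  have op: "C \<otimes>\<^bsub>Q Mod N\<^esub> C' = C <#> C'" and one: "\<one>\<^bsub>Q Mod N\<^esub> = N" for C C'
    by (simp_all add: FactGroup_def)
  have car: "N #> x \<in> carrier (Q Mod N)" if "x \<in> carrier Q" for x
    using that by (auto simp: FactGroup_def RCOSETS_def)
  have N1: "N #> \<one> = N"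
    by (rule r_coset_mem[OF N]) (use N in \<open>simp add: normal_subloop_def subloop_def\<close>)
  have f_Mlt: "f \<in> Mlt Q" and f_one: "f \<one> = \<one>"
    using f by (simp_all add: Inn_def)
  obtain C where C: "C \<in> carrier (Q Mod N)"
    "\<And>z. z \<in> carrier Q \<Longrightarrow> N #> f z = C <#> (N #> z)"
    using Mlt_acts_by_translation[OF N G f_Mlt] by blast
  have "C = N"
    using C(2)[OF one_closed] f_one N1 G.r_one[OF C(1), unfolded op one] by simp
  then have "N #> f z = N #> z"
    using C(2)[OF z] G.l_one[OF car[OF z], unfolded op one] by simp
  then have "f z \<in> N #> z"
    using r_coset_self[OF N Bij_closed[OF Inn_Bij[OF f] z]] by simp
  then obtain n where "n \<in> N" "f z = n \<otimes> z"
    by (auto simp: r_coset_def)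
  then show ?thesis
    using mult_rdiv[OF z, of n] normal_subloop_sub[OF N] by auto
qed

section \<open>The subloop generated by the quotients \<open>f z \<oslash> z\<close>\<close>

lemma subloop_generated_subloop:
  assumes "S \<subseteq> carrier Q"
  shows "subloop (subloop_generated Q S) Q"
proof -
  \<comment> \<open>This makes the family intersected by \<open>hull\<close> nonempty; an empty
    intersection would be the whole type rather than a subset of the carrier.\<close>
  have "subloop (carrier Q) Q"
    by (simp add: subloop_def one_closed mult_closed ldiv_closed rdiv_closed)
  then have "subloop_generated Q S \<subseteq> carrier Q"
    using assms unfolding subloop_generated_def by (intro hull_minimal)
  then show ?thesis
    unfolding subloop_def[of "subloop_generated Q S"]
    by (auto simp: subloop_generated_def hull_def subloop_def)
qed

text \<open>The statement about words is the case in which \<open>A\<close> consists of the word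
  maps.\<close>

theorem derived_subloop_eq_generated:
  assumes gen: "Inn Q = generate (BijGroup (carrier Q)) A"
  shows "derived_subloop Q = subloop_generated Q {f z \<oslash> z | f z. f \<in> A \<and> z \<in> carrier Q}"
    (is "_ = subloop_generated Q ?S")
proof -
  let ?B = "BijGroup (carrier Q)"
  let ?D = "subloop_generated Q ?S"
  have A_Inn: "A \<subseteq> Inn Q"
    unfolding gen by (auto intro: generate.incl)
  have S_carrier: "?S \<subseteq> carrier Q"
    using A_Inn Bij_closed[OF Inn_Bij] rdiv_closed by auto
  have sub: "subloop ?D Q"
    by (rule subloop_generated_subloop[OF S_carrier])
  then have D_carrier: "?D \<subseteq> carrier Q"
    and D_mult: "\<And>x y. x \<in> ?D \<Longrightarrow> y \<in> ?D \<Longrightarrow> x \<otimes> y \<in> ?D"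
    and D_ldiv: "\<And>x y. x \<in> ?D \<Longrightarrow> y \<in> ?D \<Longrightarrow> x \<setminus> y \<in> ?D"
    unfolding subloop_def by blast+
  \<comment> \<open>Here \<open>z\<close> ranges over the whole carrier, which is needed both for
    inverses of generators and for the action on all cosets.\<close>
  have A_step: "\<exists>e\<in>?D. f z = e \<otimes> z" if "f \<in> A" "z \<in> carrier Q" for f z
  proof (intro bexI)
    have "f \<in> Inn Q"
      using that(1) A_Inn by blast
    then show "f z = (f z \<oslash> z) \<otimes> z"
      by (rule rdiv_mult[OF that(2) Bij_closed[OF Inn_Bij that(2)], symmetric])
    show "f z \<oslash> z \<in> ?D"
      using that hull_subset[of ?S "\<lambda>N. subloop N Q"] unfolding subloop_generated_def by blast
  qed
  have invariant: "f ` ?D \<subseteq> ?D" if "f \<in> Inn Q" for f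
    using that[unfolded gen]
  proof (induction rule: generate.induct)
    case one
    show ?case
      using D_carrier by (auto simp: BijGroup_def)
  next
    case (incl h)
    have "h d \<in> ?D" if d: "d \<in> ?D" for d
      using A_step[OF incl subsetD[OF D_carrier d]] D_mult[OF _ d] by auto
    then show ?case
      by blast
  next
    case (inv h)
    have "(inv\<^bsub>?B\<^esub> h) d \<in> ?D" if d: "d \<in> ?D" for d
    proof -
      have h: "h \<in> Bij (carrier Q)"
        using inv A_Inn Inn_Bij by blast
      \<comment> \<open>The preimage \<open>y\<close> is not yet known to lie in the subloop. From
        \<open>d = h y = e \<otimes> y\<close> it is recovered as \<open>e \<setminus> d\<close>, so
        closure under left division gives membership.\<close>
      define y where "y = (inv\<^bsub>?B\<^esub> h) d"
      have y: "h y = d" "y \<in> carrier Q"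
        using Bij_apply_inv[OF h subsetD[OF D_carrier d]] by (simp_all add: y_def)
      obtain e where e: "e \<in> ?D" "h y = e \<otimes> y"
        using A_step[OF inv y(2)] by blast
      have "y = e \<setminus> d"
        using ldiv_mult[OF subsetD[OF D_carrier e(1)] y(2)] y(1) e(2) by simp
      then show ?thesis
        using D_ldiv[OF e(1) d] by (simp add: y_def)
    qed
    then show ?case
      by blast
  next
    case (eng f g)
    have fg: "f \<in> Bij (carrier Q)" "g \<in> Bij (carrier Q)"
      by (rule Inn_Bij, unfold gen, rule eng.hyps)+
    have "(f \<otimes>\<^bsub>?B\<^esub> g) d \<in> ?D" if "d \<in> ?D" for d
      unfolding BijGroup_mult_apply[OF fg subsetD[OF D_carrier that]]
      using eng.IH that by blast
    then show ?case
      by blast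
  qed
  then have normal: "normal_subloop ?D Q"
    by (intro normal_subloopI sub)
  have A_coset: "?D #> f z = ?D #> z" if "f \<in> A" "z \<in> carrier Q" for f z
    by (rule r_coset_eq[OF normal that(2)]) (use A_step[OF that] in \<open>auto simp: r_coset_def\<close>)
  \<comment> \<open>Equality of cosets, rather than membership of \<open>f z\<close> in the coset of
    \<open>z\<close>, passes directly through composites and inverses.\<close>
  have fixes_cosets: "\<forall>z\<in>carrier Q. ?D #> f z = ?D #> z" if "f \<in> Inn Q" for f
    using that[unfolded gen]
  proof (induction rule: generate.induct)
    case one
    show ?case
      by (simp add: BijGroup_def)
  next
    case (incl h)
    then show ?case
      using A_coset by blast
  next
    case (inv h)
    then have h: "h \<in> Bij (carrier Q)"
      using A_Inn Inn_Bij by blast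
    show ?case
      using A_coset[OF inv Bij_apply_inv(2)[OF h]] Bij_apply_inv(1)[OF h] by simp
  next
    case (eng f g)
    have fg: "f \<in> Bij (carrier Q)" "g \<in> Bij (carrier Q)"
      by (rule Inn_Bij, unfold gen, rule eng.hyps)+
    then show ?case
      using eng.IH by (simp add: BijGroup_mult_apply Bij_closed)
  qed
  have "comm_group (Q Mod ?D)"
  proof (rule factor_comm_group[OF normal])
    fix f z assume fz: "f \<in> Inn Q" "z \<in> carrier Q"
    show "f z \<in> ?D #> z"
      using r_coset_self[OF normal Bij_closed[OF Inn_Bij[OF fz(1)] fz(2)]] fixes_cosets fz by simp
  qed
  \<comment> \<open>Minimality: each competing \<open>N\<close> is a subloop containing every
    generator, by \<open>Inn_rdiv_mem\<close>.\<close>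
  moreover have "?D \<subseteq> N" if "normal_subloop N Q" "comm_group (Q Mod N)" for N
    unfolding subloop_generated_def
  proof (rule hull_minimal)
    show "?S \<subseteq> N"
      using Inn_rdiv_mem[OF that] A_Inn by blast
    show "subloop N Q"
      using that(1) by (simp add: normal_subloop_def)
  qed
  ultimately show ?thesis
    unfolding derived_subloop_def using normal by (intro Least_equality) auto
qed

end

theorem theorem8p2:
  fixes V :: "'a loop set" and \<W> :: "word set" and Q :: "'a loop"
  assumes "loop_variety V"
    and "generates_inner_mapping_groups V \<W>"
    and "Q \<in> V"
  shows "derived_subloop Q =
    subloop_generated Q
      {word_map Q W a z \<oslash>\<^bsub>Q\<^esub> z | W a z. W \<in> \<W> \<and> a \<in> tuples Q (arity W) \<and> z \<in> carrier Q}"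
proof -
  let ?A = "{word_map Q W a | W a. W \<in> \<W> \<and> a \<in> tuples Q (arity W)}"
  have "loop Q"
    using assms(1,3) unfolding loop_variety_def by blast
  moreover have "Inn Q = generate (BijGroup (carrier Q)) ?A"
    using assms(2,3) unfolding generates_inner_mapping_groups_def by blast
  ultimately have "derived_subloop Q =
      subloop_generated Q {f z \<oslash>\<^bsub>Q\<^esub> z | f z. f \<in> ?A \<and> z \<in> carrier Q}"
    by (rule loop.derived_subloop_eq_generated)
  also have "{f z \<oslash>\<^bsub>Q\<^esub> z | f z. f \<in> ?A \<and> z \<in> carrier Q} =
      {word_map Q W a z \<oslash>\<^bsub>Q\<^esub> z | W a z. W \<in> \<W> \<and> a \<in> tuples Q (arity W) \<and> z \<in> carrier Q}"
    by blast
  finally show ?thesis .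
qed

end
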